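(* Let $p\in\mathbb{Z}_{\ge 0}$ and let $$\chi(z)=\sum_{n=-p}^{\infty}\chi_{-n}z^{n-1}\in\mathbb{C}((z))$$ satisfy $\chi_p\neq 0$ and, in the case $p=0$, also $\chi_0\in\{1\}\cup(\mathbb{C}\setminus\mathbb{Z})$. Then $\widetilde F_{\chi}$ is an irreducible $\mathcal{V}$-module.
   Context: $F$: the Clifford algebra $CL$ is the complex associative algebra generated by $\Psi^{\pm}(r)$, $r\in\frac12+\mathbb{Z}$, with relations $\{\Psi^{\pm}(r),\Psi^{\mp}(s)\}=\delta_{r+s,0}$, $\{\Psi^{\pm}(r),\Psi^{\pm}(s)\}=0$. $F$ is the irreducible $CL$-module generated by a vector $\mathbf 1$ with $\Psi^{\pm}(r)\mathbf 1=0$ for $r>0$; it is a simple vertex superalgebra generated by the fields $\Psi^{\pm}(z)=\sum_{n\in\mathbb{Z}}\Psi^{\pm}(n+\frac12)z^{-n-1}$. $\widetilde F=\mathrm{Ker}_F\Psi^-(\frac12)$ is the vertex subalgebra of $F$ generated by $\partial\Psi^+(z)$ and $\Psi^-(z)$; it is spanned by the monomials in $\Psi^+(-n-\frac12)$ ($n\ge 1$) and $\Psi^-(-k-\frac12)$ ($k\ge 0$) applied to $\mathbf 1$. $M(0)=\mathbb{C}[\gamma^{+}(n),\gamma^{-}(n)\mid n<0]$ is the commutative vertex algebra generated by the fields $\gamma^{\pm}(z)=\sum_{n<0}\gamma^{\pm}(n)z^{-n-1}$. For $\chi^{\pm}(z)=\sum_{n\in\mathbb{Z}}\chi^{\pm}_n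 z^{-n-1}\in\mathbb{C}((z))$, $M(0,\chi^+,\chi^-)$ is the one-dimensional $M(0)$-module on which $\gamma^{\pm}(z)$ acts as $\chi^{\pm}(z)$. $\mathcal{V}$ is the vertex subalgebra of the vertex superalgebra $F\otimes M(0)$ generated by $\tau^{\pm}=(\Psi^{\pm}(-\frac32)+\gamma^{\pm}(-1)\Psi^{\pm}(-\frac12))\mathbf 1$, $j=\frac12(\gamma^+(-1)-\gamma^-(-1))\mathbf 1$, $\nu=\frac14(2\gamma^+(-1)\gamma^-(-1)+\gamma^+(-2)+\gamma^-(-2))\mathbf 1$. The modes of the fields $G^{\pm}(z)=Y(\tau^\pm,z)=\sum_n G^{\pm}(n+\frac12)z^{-n-2}$, $S(z)=Y(\nu,z)=\sum_n S(n)z^{-n-2}$, $T(z)=Y(j,z)=\sum_n T(n)z^{-n-1}$ span a Lie superalgebra $\mathcal{A}$ in which $S(n),T(n)$ are central, $\{G^\pm(r),G^\pm(s)\}=0$ and $\{G^+(r),G^-(s)\}=2S(r+s)+(r-s)T(r+s)-(r^2-\frac14)\delta_{r+s,0}$. $F(\chi^+,\chi^-):=F\otimes M(0,\chi^+,\chi^-)$ is a $\mathcal{V}$-module, and $\widetilde F_\chi:=\widetilde F\otimes M(0,0,\chi)$ is a $\mathcal{V}$-submodule of $F(0,\chi)$. Identified with $\widetilde F$ as a vector space, the action on $\widetilde F_\chi$ is $G^{+}(i-\frac12)=-i\Psi^{+}(i-\frac12)$, $G^{-}(i-\frac12)=-i\Psi^{-}(i-\frac12)+\sum_{k\ge -p}\chi_{-k}\Psi^{-}(k+i-\frac12)$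 ($i\in\mathbb{Z}$), while $T(z)$ and $S(z)$ act as the scalar series $-\frac12\chi(z)$ and $\frac14\partial_z\chi(z)$. A $\mathcal{V}$-module is irreducible iff it is irreducible under $\mathcal{A}$. *)

theory Defs
  imports
    "HOL-Library.Poly_Mapping"
    "HOL-Library.Product_Plus"
    "HOL-Library.Multiset"
    "HOL-Library.FSet"
    "HOL-Computational_Algebra.Formal_Laurent_Series"
    Complex_Main
begin

section \<open>Free complex vector spaces and fields\<close>

type_synonym 'b vec = "'b \<Rightarrow>\<^sub>0 complex"

definition cscale :: "complex \<Rightarrow> 'b vec \<Rightarrow> 'b vec" (infixr \<open>*\<^sub>c\<close> 75) where
  "c *\<^sub>c v = Poly_Mapping.map ((*) c) v"

lemma lookup_cscale [simp]: "Poly_Mapping.lookup (c *\<^sub>c v) b = c * Poly_Mapping.lookup v b"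
  by (simp add: cscale_def Poly_Mapping.map.rep_eq when_def)

global_interpretation cvec: vector_space "cscale :: complex \<Rightarrow> 'b vec \<Rightarrow> 'b vec"
  by unfold_locales
    (auto intro!: poly_mapping_eqI simp: lookup_add algebra_simps)

definition basis_vec :: "'b \<Rightarrow> 'b vec" where
  "basis_vec b = Poly_Mapping.single b 1"

definition lin_ext :: "('b \<Rightarrow> 'c vec) \<Rightarrow> 'b vec \<Rightarrow> 'c vec" where
  "lin_ext g v = (\<Sum>b\<in>Poly_Mapping.keys v. Poly_Mapping.lookup v b *\<^sub>c g b)"

text \<open>
  A formal field \<open>A(z) = \<Sum>\<^sub>n A\<^sub>n z\<^sup>-\<^sup>n\<^sup>-\<^sup>1\<close> is represented by its modes: \<open>A n\<close> is
  the coefficient of \<open>z\<^sup>-\<^sup>n\<^sup>-\<^sup>1\<close>.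
\<close>

type_synonym 'b modes = "int \<Rightarrow> 'b vec \<Rightarrow> 'b vec"

definition id_field :: "'b modes" where
  "id_field n v = (if n = -1 then v else 0)"

definition deriv_field :: "'b modes \<Rightarrow> 'b modes" where
  "deriv_field A n v = of_int (- n) *\<^sub>c A (n - 1) v"

definition divided_deriv :: "nat \<Rightarrow> 'b modes \<Rightarrow> 'b modes" where
  "divided_deriv k A n v = (1 / fact k) *\<^sub>c (deriv_field ^^ k) A n v"

text \<open>
  Normally ordered product \<open>:A(z)B(z): = A\<^sub>-(z) B(z) + s B(z) A\<^sub>+(z)\<close>, where \<open>A\<^sub>-\<close> collects
  the modes \<open>A\<^sub>m\<close> with \<open>m < 0\<close>, \<open>A\<^sub>+\<close> those with \<open>m \<ge> 0\<close>, and \<open>s = -1\<close> if both fields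
  are odd, \<open>s = 1\<close> otherwise. For genuine fields only finitely many of the summands applied to
  a given vector are nonzero, so the sum over all integers \<open>m\<close> is meaningful.
\<close>

definition normal_prod :: "complex \<Rightarrow> 'b modes \<Rightarrow> 'b modes \<Rightarrow> 'b modes" where
  "normal_prod s A B n v = Sum_any (\<lambda>m::int.
     if m < 0 then A m (B (n - m - 1) v) else s *\<^sub>c B (n - m - 1) (A m v))"


section \<open>The Clifford module and the commutative vertex algebra\<close>

datatype pm = Pos | Neg

text \<open>
  The fermionic Fock space \<open>F\<close>: the pair \<open>(A, B)\<close> with \<open>A = {a\<^sub>1 < \<dots> < a\<^sub>k}\<close> and
  \<open>B = {b\<^sub>1 < \<dots> < b\<^sub>l}\<close> stands for the monomial
  \<open>\<Psi>\<^sup>+(-a\<^sub>1-1/2) \<dots> \<Psi>\<^sup>+(-a\<^sub>k-1/2) \<Psi>\<^sup>-(-b\<^sub>1-1/2) \<dots> \<Psi>\<^sup>-(-b\<^sub>l-1/2) 1\<close>.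
\<close>

type_synonym fock = "nat fset \<times> nat fset"

definition number_below :: "nat \<Rightarrow> nat fset \<Rightarrow> nat" where
  "number_below a A = card {x. x |\<in>| A \<and> x < a}"

text \<open>
  \<open>psi e n\<close> is the operator \<open>\<Psi>\<^sup>e(n + 1/2)\<close>, hence the \<open>n\<close>-th mode of the field
  \<open>\<Psi>\<^sup>e(z) = \<Sum>\<^sub>n \<Psi>\<^sup>e(n + 1/2) z\<^sup>-\<^sup>n\<^sup>-\<^sup>1\<close>. For \<open>n < 0\<close> it adds the factor
  \<open>\<Psi>\<^sup>e(-a-1/2)\<close> with \<open>a = - n - 1\<close>; for \<open>n \<ge> 0\<close> it contracts with the factor of opposite
  sign \<open>\<Psi>\<^sup>-\<^sup>e(-n-1/2)\<close>.
\<close>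

fun psi_basis :: "pm \<Rightarrow> int \<Rightarrow> fock \<Rightarrow> fock vec" where
  "psi_basis Pos n (A, B) =
    (if n < 0 then
       (if nat (- n - 1) |\<in>| A then 0
        else Poly_Mapping.single (finsert (nat (- n - 1)) A, B)
               ((-1) ^ number_below (nat (- n - 1)) A))
     else
       (if nat n |\<in>| B
        then Poly_Mapping.single (A, B |-| {|nat n|}) ((-1) ^ (fcard A + number_below (nat n) B))
        else 0))"
| "psi_basis Neg n (A, B) =
    (if n < 0 then
       (if nat (- n - 1) |\<in>| B then 0
        else Poly_Mapping.single (A, finsert (nat (- n - 1)) B)
               ((-1) ^ (fcard A + number_below (nat (- n - 1)) B)))
     else
       (if nat n |\<in>| A
        then Poly_Mapping.single (A |-| {|nat n|}, B) ((-1) ^ number_below (nat n) A)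
        else 0))"

definition psi :: "pm \<Rightarrow> fock modes" where
  "psi e n = lin_ext (psi_basis e n)"

definition fock_vacuum :: "fock vec" where
  "fock_vacuum = basis_vec ({||}, {||})"

text \<open>
  The pair of multisets \<open>(P, Q)\<close> stands for the monomial with one factor \<open>\<gamma>\<^sup>+(-k-1)\<close> for
  each \<open>k\<close> in \<open>P\<close> and one factor \<open>\<gamma>\<^sup>-(-k-1)\<close> for each \<open>k\<close> in \<open>Q\<close>, so that
  \<open>gmono vec\<close> with its convolution product is the polynomial ring \<open>M(0)\<close>.
\<close>

type_synonym gmono = "nat multiset \<times> nat multiset"

definition gamma_var :: "pm \<Rightarrow> nat \<Rightarrow> gmono vec" where
  "gamma_var e k = basis_vec (case e of Pos \<Rightarrow> ({#k#}, {#}) | Neg \<Rightarrow> ({#}, {#k#}))"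

definition gamma :: "pm \<Rightarrow> gmono modes" where
  "gamma e n v = (if n < 0 then gamma_var e (nat (- n - 1)) * v else 0)"


section \<open>The vertex superalgebra on the tensor product and its modules\<close>

text \<open>
  \<open>F \<otimes> M(0)\<close> has the basis \<open>fock \<times> gmono\<close>. For linear \<open>T\<close>, \<open>on_left T\<close> and \<open>on_right T\<close> are
  \<open>T \<otimes> id\<close> and \<open>id \<otimes> T\<close>; no signs occur since \<open>M(0)\<close> is purely even.
\<close>

type_synonym state = "(fock \<times> gmono) vec"

definition on_left :: "('a vec \<Rightarrow> 'a vec) \<Rightarrow> ('a \<times> 'b) vec \<Rightarrow> ('a \<times> 'b) vec" where
  "on_left T = lin_ext (\<lambda>(a, b). lin_ext (\<lambda>a'. basis_vec (a', b)) (T (basis_vec a)))"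

definition on_right :: "('b vec \<Rightarrow> 'b vec) \<Rightarrow> ('a \<times> 'b) vec \<Rightarrow> ('a \<times> 'b) vec" where
  "on_right T = lin_ext (\<lambda>(a, b). lin_ext (\<lambda>b'. basis_vec (a, b')) (T (basis_vec b)))"

definition Psi_op :: "pm \<Rightarrow> (fock \<times> gmono) modes" where
  "Psi_op e n = on_left (psi e n)"

definition Gamma_op :: "pm \<Rightarrow> (fock \<times> gmono) modes" where
  "Gamma_op e n = on_right (gamma e n)"

definition vacuum :: state where
  "vacuum = basis_vec (({||}, {||}), ({#}, {#}))"

text \<open>
  The letters \<open>Psi_l e n\<close> and \<open>Gamma_l e n\<close> are the creation operators \<open>\<Psi>\<^sup>e(-n-1/2)\<close> and
  \<open>\<gamma>\<^sup>e(-n-1)\<close>, that is the modes with index \<open>-n-1\<close> of the generating fields; \<open>word_of\<close> spells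
  a basis vector of \<open>F \<otimes> M(0)\<close> as a product of such letters applied to the vacuum.
\<close>

datatype letter = Psi_l pm nat | Gamma_l pm nat

fun odd_letter :: "letter \<Rightarrow> bool" where
  "odd_letter (Psi_l e n) = True"
| "odd_letter (Gamma_l e n) = False"

definition odd_word :: "letter list \<Rightarrow> bool" where
  "odd_word w = odd (length (filter odd_letter w))"

fun word_of :: "fock \<times> gmono \<Rightarrow> letter list" where
  "word_of ((A, B), (P, Q)) =
     map (Psi_l Pos) (sorted_list_of_fset A) @ map (Psi_l Neg) (sorted_list_of_fset B) @
     map (Gamma_l Pos) (sorted_list_of_multiset P) @ map (Gamma_l Neg) (sorted_list_of_multiset Q)"

text \<open>
  The state-field correspondence of the free-field vertex superalgebra \<open>F \<otimes> M(0)\<close>, with values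
  in the fields on a space on which the generating fields \<open>\<Psi>\<^sup>\<plusminus>(z)\<close> and \<open>\<gamma>\<^sup>\<plusminus>(z)\<close> act by the
  modes \<open>X\<close> and \<open>C\<close>: the state \<open>a\<^sub>-\<^sub>n\<^sub>-\<^sub>1 v\<close>, with \<open>a\<close> a generator, is sent to the
  normally ordered product \<open>:\<partial>\<^sup>(\<^sup>n\<^sup>)a(z) Y(v,z):\<close> with \<open>\<partial>\<^sup>(\<^sup>n\<^sup>) = \<partial>\<^sup>n/n!\<close>.
\<close>

fun letter_field :: "(pm \<Rightarrow> 'b modes) \<Rightarrow> (pm \<Rightarrow> 'b modes) \<Rightarrow> letter \<Rightarrow> 'b modes" where
  "letter_field X C (Psi_l e n) = divided_deriv n (X e)"
| "letter_field X C (Gamma_l e n) = divided_deriv n (C e)"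

fun word_field :: "(pm \<Rightarrow> 'b modes) \<Rightarrow> (pm \<Rightarrow> 'b modes) \<Rightarrow> letter list \<Rightarrow> 'b modes" where
  "word_field X C [] = id_field"
| "word_field X C (a # w) =
     normal_prod (if odd_letter a \<and> odd_word w then -1 else 1)
       (letter_field X C a) (word_field X C w)"

definition free_field_map ::
  "(pm \<Rightarrow> 'b modes) \<Rightarrow> (pm \<Rightarrow> 'b modes) \<Rightarrow> state \<Rightarrow> 'b modes" where
  "free_field_map X C u n v = (\<Sum>b\<in>Poly_Mapping.keys u.
     Poly_Mapping.lookup u b *\<^sub>c word_field X C (word_of b) n v)"

text \<open>The vertex operators \<open>Y(u,z) = \<Sum>\<^sub>n u\<^sub>n z\<^sup>-\<^sup>n\<^sup>-\<^sup>1\<close> of \<open>F \<otimes> M(0)\<close>: \<open>Y u n v = u\<^sub>n v\<close>.\<close>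

definition Y :: "state \<Rightarrow> (fock \<times> gmono) modes" where
  "Y = free_field_map Psi_op Gamma_op"

text \<open>
  \<open>chi_mode \<chi> n\<close> is \<open>\<chi>\<^sub>n\<close> in \<open>\<chi>(z) = \<Sum>\<^sub>n \<chi>\<^sub>n z\<^sup>-\<^sup>n\<^sup>-\<^sup>1\<close>.
\<close>

definition chi_mode :: "complex fls \<Rightarrow> int \<Rightarrow> complex" where
  "chi_mode \<chi> n = fls_nth \<chi> (- n - 1)"

fun chi_field :: "complex fls \<Rightarrow> complex fls \<Rightarrow> pm \<Rightarrow> 'b modes" where
  "chi_field \<chi>p \<chi>m Pos n v = chi_mode \<chi>p n *\<^sub>c v"
| "chi_field \<chi>p \<chi>m Neg n v = chi_mode \<chi>m n *\<^sub>c v"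

text \<open>
  The module \<open>F(\<chi>\<^sup>+,\<chi>\<^sup>-) = F \<otimes> M(0,\<chi>\<^sup>+,\<chi>\<^sup>-)\<close>, with underlying space \<open>F\<close> since
  \<open>M(0,\<chi>\<^sup>+,\<chi>\<^sup>-)\<close> is one-dimensional.
\<close>

definition Y_F :: "complex fls \<Rightarrow> complex fls \<Rightarrow> state \<Rightarrow> fock modes" where
  "Y_F \<chi>p \<chi>m = free_field_map psi (chi_field \<chi>p \<chi>m)"


section \<open>Vertex subalgebras and irreducible modules\<close>

inductive_set vertex_subalgebra_generated :: "state set \<Rightarrow> state set" for S where
  vacuum: "vacuum \<in> vertex_subalgebra_generated S"
| generator: "u \<in> S \<Longrightarrow> u \<in> vertex_subalgebra_generated S"
| add: "u \<in> vertex_subalgebra_generated S \<Longrightarrow> v \<in> vertex_subalgebra_generated S \<Longrightarrow>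
    u + v \<in> vertex_subalgebra_generated S"
| scale: "u \<in> vertex_subalgebra_generated S \<Longrightarrow> c *\<^sub>c u \<in> vertex_subalgebra_generated S"
| nth_product: "u \<in> vertex_subalgebra_generated S \<Longrightarrow> v \<in> vertex_subalgebra_generated S \<Longrightarrow>
    Y u n v \<in> vertex_subalgebra_generated S"

text \<open>
  For a vertex subalgebra \<open>U\<close> of \<open>F \<otimes> M(0)\<close> acting on a space by \<open>YM\<close>: submodules are the
  subspaces stable under all modes of all fields \<open>YM u\<close> with \<open>u\<close> in \<open>U\<close>, and a submodule is an
  irreducible \<open>U\<close>-module if it is nonzero and has no submodules besides \<open>0\<close> and itself.
\<close>

definition is_submodule :: "state set \<Rightarrow> (state \<Rightarrow> 'b modes) \<Rightarrow> 'b vec set \<Rightarrow> bool" where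
  "is_submodule U YM W \<longleftrightarrow>
     cvec.subspace W \<and> (\<forall>u\<in>U. \<forall>n. \<forall>w\<in>W. YM u n w \<in> W)"

definition is_irreducible_module ::
  "state set \<Rightarrow> (state \<Rightarrow> 'b modes) \<Rightarrow> 'b vec set \<Rightarrow> bool" where
  "is_irreducible_module U YM W \<longleftrightarrow>
     is_submodule U YM W \<and> W \<noteq> {0} \<and>
     (\<forall>W'. W' \<subseteq> W \<and> is_submodule U YM W' \<longrightarrow> W' = {0} \<or> W' = W)"


section \<open>The vertex algebra generated by \<open>\<tau>\<^sup>\<plusminus>\<close>, \<open>j\<close>, \<open>\<nu>\<close> and its module on the kernel\<close>

definition tau :: "pm \<Rightarrow> state" where
  "tau e = Psi_op e (-2) vacuum + Gamma_op e (-1) (Psi_op e (-1) vacuum)"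

definition jvec :: state where
  "jvec = (1/2) *\<^sub>c (Gamma_op Pos (-1) vacuum - Gamma_op Neg (-1) vacuum)"

definition nu :: state where
  "nu = (1/4) *\<^sub>c (2 *\<^sub>c Gamma_op Pos (-1) (Gamma_op Neg (-1) vacuum)
     + Gamma_op Pos (-2) vacuum + Gamma_op Neg (-2) vacuum)"

definition V :: "state set" where
  "V = vertex_subalgebra_generated {tau Pos, tau Neg, jvec, nu}"

definition F_tilde :: "fock vec set" where
  "F_tilde = {v. psi Neg 0 v = 0}"

section \<open>The action of the generating fields\<close>

text \<open>
  \<open>G\<^sup>\<plusminus>(i - 1/2)\<close>, \<open>T(i)\<close> and \<open>S(i - 1)\<close> are the modes with index \<open>i\<close> of \<open>\<tau>\<^sup>\<plusminus>\<close>, \<open>j\<close> and \<open>\<nu>\<close>.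
  The lemmas \<open>Y_F_tau\<close>, \<open>Y_F_jvec\<close> and \<open>Y_F_nu\<close> recover their explicit action on \<open>F(0,\<chi>)\<close>:
  \<open>G\<^sup>+(i - 1/2) = -i \<Psi>\<^sup>+(i - 1/2)\<close>,
  \<open>G\<^sup>-(i - 1/2) = -i \<Psi>\<^sup>-(i - 1/2) + \<Sum>\<^sub>k \<chi>\<^sub>-\<^sub>k \<Psi>\<^sup>-(k + i - 1/2)\<close>,
  \<open>T(z) = -\<chi>(z)/2\<close> and \<open>S(z) = \<partial>\<chi>(z)/4\<close>.
\<close>

lemma cscale_single [simp]: "c *\<^sub>c Poly_Mapping.single b d = Poly_Mapping.single b (c * d)"
  by (rule poly_mapping_eqI) (simp add: lookup_single when_def)

lemma lin_ext_single [simp]: "lin_ext g (Poly_Mapping.single b c) = c *\<^sub>c g b"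
  by (cases "c = 0") (auto simp: lin_ext_def)

lemma lin_ext_zero [simp]: "lin_ext g 0 = 0"
  by (simp add: lin_ext_def)

lemma lin_ext_superset:
  assumes "finite K" "Poly_Mapping.keys v \<subseteq> K"
  shows "lin_ext g v = (\<Sum>b\<in>K. Poly_Mapping.lookup v b *\<^sub>c g b)"
  unfolding lin_ext_def
  by (rule sum.mono_neutral_left) (use assms in \<open>auto simp: in_keys_iff\<close>)

lemma lin_ext_scale: "lin_ext g (c *\<^sub>c v) = c *\<^sub>c lin_ext g v"
proof -
  have "Poly_Mapping.keys (c *\<^sub>c v) \<subseteq> Poly_Mapping.keys v" by (auto simp: in_keys_iff)
  then show ?thesis
    by (simp add: lin_ext_superset[of "Poly_Mapping.keys v"] cvec.scale_sum_right)
qed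

lemma psi_scale: "psi e n (c *\<^sub>c v) = c *\<^sub>c psi e n v"
  by (simp add: psi_def lin_ext_scale)

lemma free_field_map_lin_ext: "free_field_map X C u n v = lin_ext (\<lambda>b. word_field X C (word_of b) n v) u"
  by (simp add: free_field_map_def lin_ext_def)

lemma lin_ext_add: "lin_ext g (u + v) = lin_ext g u + lin_ext g v"
proof -
  let ?K = "Poly_Mapping.keys u \<union> Poly_Mapping.keys v"
  have f: "finite ?K" by simp
  show ?thesis
    by (simp add: lin_ext_superset[of ?K] Poly_Mapping.keys_add lookup_add cvec.scale_left_distrib sum.distrib)
qed

lemma Psi_op_vacuum: "Psi_op e (- int n - 1) vacuum = basis_vec (case e of Pos \<Rightarrow> ({|n|},{||}) | Neg \<Rightarrow> ({||},{|n|}), ({#},{#}))"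
  by (cases e) (auto simp: Psi_op_def on_left_def vacuum_def basis_vec_def psi_def number_below_def fcard.rep_eq)

lemma Gamma_op_basis: "Gamma_op e (- int n - 1) (basis_vec (s,(P,Q))) = basis_vec (s, case e of Pos \<Rightarrow> (add_mset n P,Q) | Neg \<Rightarrow> (P,add_mset n Q))"
  by (cases e) (auto simp: Gamma_op_def on_right_def basis_vec_def gamma_def gamma_var_def mult_single)

lemma tau_expand: "tau e = basis_vec (case e of Pos \<Rightarrow> ({|1|},{||}) | Neg \<Rightarrow> ({||},{|1|}), ({#},{#}))
  + basis_vec (case e of Pos \<Rightarrow> ({|0|},{||}) | Neg \<Rightarrow> ({||},{|0|}), case e of Pos \<Rightarrow> ({#0#},{#}) | Neg \<Rightarrow> ({#},{#0#}))"
  using Psi_op_vacuum[of e 1] Psi_op_vacuum[of e 0] Gamma_op_basis[of e 0 _ "{#}" "{#}"]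
  by (cases e) (auto simp: tau_def)

lemma jvec_expand: "jvec = Poly_Mapping.single (({||},{||}), ({#0#},{#})) (1/2) + Poly_Mapping.single (({||},{||}), ({#},{#0#})) (-1/2)"
  using Gamma_op_basis[of _ 0 _ "{#}" "{#}"]
  by (intro poly_mapping_eqI)
    (simp add: jvec_def vacuum_def basis_vec_def lookup_add lookup_minus lookup_single when_def)

lemma nu_expand: "nu = Poly_Mapping.single (({||},{||}), ({#0#},{#0#})) (1/2)
   + Poly_Mapping.single (({||},{||}), ({#1#},{#})) (1/4) + Poly_Mapping.single (({||},{||}), ({#},{#1#})) (1/4)"
  using Gamma_op_basis[of Pos 0 _ "{#}" "{#}"] Gamma_op_basis[of Neg 0 _ "{#}" "{#}"] Gamma_op_basis[of _ 0 _ "{#}" "{#0#}"] Gamma_op_basis[of _ 1 _ "{#}" "{#}"]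
  by (simp add: nu_def vacuum_def basis_vec_def cvec.scale_right_distrib)

lemma Sum_any_only: "(\<And>m. m \<noteq> n \<Longrightarrow> f m = 0) \<Longrightarrow> Sum_any f = f n"
  by (metis (no_types, lifting) Sum_any.cong Sum_any_when_equal when_def)

lemma normal_prod_id_field:
  assumes "\<And>m. A m 0 = 0" shows "normal_prod 1 A id_field n v = A n v"
  unfolding normal_prod_def id_field_def
  by (subst Sum_any_only[where n=n]) (auto simp: assms)

lemma divided_deriv_0: "divided_deriv 0 A = A" by (auto simp: divided_deriv_def fun_eq_iff)
lemma divided_deriv_1: "divided_deriv 1 A = deriv_field A" by (auto simp: divided_deriv_def fun_eq_iff)

lemma chi_mode_zero: "chi_mode 0 n = 0" by (simp add: chi_mode_def)

lemma chi_field_alt: "chi_field a b e n v = chi_mode (case e of Pos \<Rightarrow> a | Neg \<Rightarrow> b) n *\<^sub>c v"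
  by (cases e) auto

lemma psi_zero [simp]: "psi e n 0 = 0" by (simp add: psi_def)

lemma Y_F_tau:
  "Y_F a b (tau e) n v = of_int (- n) *\<^sub>c psi e (n - 1) v
     + Sum_any (\<lambda>k. chi_mode (case e of Pos \<Rightarrow> a | Neg \<Rightarrow> b) (-k) *\<^sub>c psi e (k + n - 1) v)"
proof -
  have s: "sorted_list_of_fset {|x|} = [x]" for x :: nat by (simp add: sorted_list_of_fset.rep_eq)
  have s0: "sorted_list_of_fset ({||} :: nat fset) = []" by (simp add: sorted_list_of_fset.rep_eq)
  let ?c = "case e of Pos \<Rightarrow> a | Neg \<Rightarrow> b"
  have id: "normal_prod 1 (chi_field a b e) id_field = (chi_field a b e :: fock modes)"
    by (intro ext normal_prod_id_field) (simp add: chi_field_alt)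
  have id2: "normal_prod 1 (deriv_field (psi e)) id_field = deriv_field (psi e)"
    by (intro ext normal_prod_id_field) (simp add: deriv_field_def)
  have "Y_F a b (tau e) n v = deriv_field (psi e) n v + normal_prod 1 (psi e) (chi_field a b e) n v"
    by (cases e) (use id id2 in \<open>simp_all add: Y_F_def free_field_map_lin_ext tau_expand lin_ext_add basis_vec_def s s0 divided_deriv_0 divided_deriv_1[simplified] odd_word_def normal_prod_id_field\<close>)
  also have "normal_prod 1 (psi e) (chi_field a b e) n v = Sum_any (\<lambda>m. chi_mode ?c (n - 1 - m) *\<^sub>c psi e m v)"
    by (auto simp: normal_prod_def chi_field_alt psi_scale algebra_simps intro!: Sum_any.cong)
  also have "\<dots> = Sum_any (\<lambda>k. chi_mode ?c (-k) *\<^sub>c psi e (k + n - 1) v)"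
    by (rule Sum_any.reindex_cong[of "\<lambda>k. k + n - 1"])
       (auto simp: fun_eq_iff intro: bij_betwI[where g = "\<lambda>m. m - n + 1"])
  finally show ?thesis by (simp add: deriv_field_def)
qed

lemma sorted_list_of_fset_empty: "sorted_list_of_fset ({||} :: nat fset) = []"
  by (simp add: sorted_list_of_fset.rep_eq)

lemma normal_prod_chi_field: "normal_prod 1 (chi_field a b e) id_field = (chi_field a b e :: 'b modes)"
  by (intro ext normal_prod_id_field) (simp add: chi_field_alt)

lemma normal_prod_deriv_chi_field:
  "normal_prod 1 (deriv_field (chi_field a b e)) id_field = (deriv_field (chi_field a b e) :: 'b modes)"
  by (intro ext normal_prod_id_field) (simp add: deriv_field_def chi_field_alt)

lemma normal_prod_chi_zero:
  assumes "\<And>m. B m 0 = 0"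
  shows "normal_prod 1 (chi_field 0 \<chi> Pos) B n v = 0"
  by (simp add: normal_prod_def chi_mode_zero assms cong: if_cong)

lemma chi_field_vec_zero: "chi_field a b e m 0 = 0"
  by (simp add: chi_field_alt)

lemmas word_field_eval = word_of.simps sorted_list_of_fset_empty sorted_list_of_multiset_singleton
  sorted_list_of_multiset_empty list.map append.simps word_field.simps letter_field.simps
  odd_letter.simps simp_thms if_False divided_deriv_0 divided_deriv_1
  normal_prod_chi_field normal_prod_deriv_chi_field

lemma Y_F_jvec: "Y_F 0 \<chi> jvec n v = (- 1/2 * chi_mode \<chi> n) *\<^sub>c v"
  unfolding Y_F_def free_field_map_lin_ext jvec_expand lin_ext_add lin_ext_single
  by (simp only: word_field_eval chi_field.simps chi_mode_zero cvec.scale_zero_left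
      cvec.scale_zero_right add_0 cvec.scale_scale)

lemma Y_F_nu: "Y_F 0 \<chi> nu n v = (1/4 * (- of_int n * chi_mode \<chi> (n - 1))) *\<^sub>c v"
  unfolding Y_F_def free_field_map_lin_ext nu_expand lin_ext_add lin_ext_single
  by (simp only: word_field_eval normal_prod_chi_zero chi_field_vec_zero deriv_field_def
      chi_field.simps chi_mode_zero cvec.scale_zero_left cvec.scale_zero_right add_0
      cvec.scale_scale of_int_minus)

end

theory Submission
  imports Defs
begin

text \<open>
  \<^emph>\<open>Stability.\<close> Since \<open>\<chi>\<^sup>+ = 0\<close>, every field of \<open>F \<otimes> M(0)\<close> whose state is divisible by some
  \<open>\<gamma>\<^sup>+(n)\<close> acts on \<open>F(0,\<chi>)\<close> as zero. Modulo these states the generators of \<open>V\<close> do not contain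
  the factor \<open>\<Psi>\<^sup>+(-1/2)\<close>: the only one in which it occurs is \<open>\<tau>\<^sup>+\<close>, where it is multiplied by
  \<open>\<gamma>\<^sup>+(-1)\<close>. So \<open>V\<close> lies in the span of the monomials that are divisible by some \<open>\<gamma>\<^sup>+(n)\<close> or free
  of \<open>\<Psi>\<^sup>+(-1/2)\<close> (\<open>V_subset_admissible\<close>). That this span is closed under all products, and that
  its fields preserve \<open>F_tilde\<close>, both follow by inspecting the letters of a monomial: the
  letter \<open>\<Psi>\<^sup>+(-a-1/2)\<close> contributes the field \<open>\<partial>\<^sup>a\<Psi>\<^sup>+(z)/a!\<close>, and for \<open>a \<ge> 1\<close> the derivative
  removes exactly the mode \<open>\<Psi>\<^sup>+(-1/2)\<close>, the only one that leads out of the span.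

  \<^emph>\<open>Irreducibility.\<close> Let \<open>W\<close> be a submodule of \<open>F_tilde\<close>. The modes of \<open>\<tau>\<^sup>+\<close> are
  \<open>-i \<Psi>\<^sup>+(i-1/2)\<close>, so \<open>W\<close> is stable under \<open>\<Psi>\<^sup>+(i-1/2)\<close> for \<open>i \<noteq> 0\<close>. In the mode of \<open>\<tau>\<^sup>-\<close> with index \<open>n + 1 + p\<close> the term
  \<open>\<Psi>\<^sup>-(n+1/2)\<close> has the lowest index, and its coefficient is \<open>\<chi>\<^sub>p\<close> if \<open>p > 0\<close> and
  \<open>\<chi>\<^sub>0 - (n+1)\<close> if \<open>p = 0\<close>. The hypothesis on \<open>\<chi>\<^sub>0\<close> makes this nonzero, with the single exception
  \<open>\<chi>\<^sub>0 = 1\<close>, \<open>n = 0\<close>, and \<open>\<Psi>\<^sup>-(1/2)\<close> is zero on \<open>F_tilde\<close> anyway. As operators of large index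
  kill a given vector, the triangular system can be solved from above
  (\<open>triangular_modes_stable\<close>), so \<open>W\<close> is stable under all \<open>\<Psi>\<^sup>-(n+1/2)\<close>. The rest is the
  irreducibility of a Clifford module: annihilators take a nonzero vector of \<open>W\<close> to a multiple of the
  vacuum, from which the creation operators produce all of \<open>F_tilde\<close>.
\<close>


section \<open>Coordinate subspaces\<close>

definition supported_on :: "'b set \<Rightarrow> 'b vec set" where
  "supported_on S = {v. Poly_Mapping.keys v \<subseteq> S}"

lemma subspace_supported_on: "cvec.subspace (supported_on S)"
  unfolding cvec.subspace_def supported_on_def
  by (auto simp: in_keys_iff lookup_add subset_iff) (metis add.right_neutral)

lemma lin_ext_in_subspace:
  assumes "cvec.subspace W" and "\<And>b. b \<in> Poly_Mapping.keys v \<Longrightarrow> g b \<in> W"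
  shows "lin_ext g v \<in> W"
  unfolding lin_ext_def by (intro cvec.subspace_sum cvec.subspace_scale assms)

lemma lin_ext_supported_on:
  assumes "v \<in> supported_on S" and "\<And>b. b \<in> S \<Longrightarrow> g b \<in> supported_on S'"
  shows "lin_ext g v \<in> supported_on S'"
  using assms by (intro lin_ext_in_subspace[OF subspace_supported_on]) (auto simp: supported_on_def)

lemma single_supported_on: "b \<in> S \<Longrightarrow> Poly_Mapping.single b c \<in> supported_on S"
  by (simp add: supported_on_def)

lemma basis_vec_supported_on: "b \<in> S \<Longrightarrow> basis_vec b \<in> supported_on S"
  by (simp add: basis_vec_def single_supported_on)

lemma supported_on_mono: "S \<subseteq> S' \<Longrightarrow> supported_on S \<subseteq> supported_on S'"
  by (auto simp: supported_on_def)

lemma zero_supported_on: "0 \<in> supported_on S"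
  by (simp add: supported_on_def)

lemma lin_ext_basis_vec: "lin_ext basis_vec v = v"
proof (rule poly_mapping_eqI)
  fix b
  show "Poly_Mapping.lookup (lin_ext basis_vec v) b = Poly_Mapping.lookup v b"
    by (auto simp: lin_ext_def basis_vec_def lookup_sum lookup_single when_def in_keys_iff)
qed

text \<open>If the support of \<open>f\<close> is infinite, \<open>Sum_any f\<close> is zero by convention and still lies in \<open>W\<close>.\<close>

lemma Sum_any_in_subspace:
  assumes "cvec.subspace W" and "\<And>m. f m \<in> W"
  shows "Sum_any f \<in> W"
  unfolding Sum_any.expand_set by (intro cvec.subspace_sum assms)


section \<open>Fields of monomials\<close>

lemma normal_prod_in_subspace:
  assumes "cvec.subspace W"
    and "\<And>m k. A m (B k v) \<in> W" and "\<And>m k. B k (A m v) \<in> W"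
  shows "normal_prod s A B n v \<in> W"
  unfolding normal_prod_def
  by (intro Sum_any_in_subspace) (auto intro: assms cvec.subspace_scale)

lemma word_field_stable:
  assumes "cvec.subspace W"
    and "\<And>a n v. a \<in> set w \<Longrightarrow> v \<in> W \<Longrightarrow> letter_field X C a n v \<in> W"
    and "v \<in> W"
  shows "word_field X C w n v \<in> W"
  using assms(2,3)
proof (induction w arbitrary: n v)
  case Nil
  then show ?case by (simp add: id_field_def cvec.subspace_0[OF assms(1)])
next
  case (Cons a w)
  then show ?case by (auto intro!: normal_prod_in_subspace assms(1))
qed

text \<open>
  A letter with values in \<open>W\<close> makes \<open>W\<close> absorb the whole word, as the remaining letters
  are applied either before it or to an element of \<open>W\<close>.
\<close>

lemma word_field_absorbed:
  assumes "cvec.subspace W"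
    and "\<And>a n v. a \<in> set w \<Longrightarrow> v \<in> W \<Longrightarrow> letter_field X C a n v \<in> W"
    and "c \<in> set w" and "\<And>n v. letter_field X C c n v \<in> W"
  shows "word_field X C w n v \<in> W"
  using assms(2,3)
proof (induction w arbitrary: n v)
  case Nil
  then show ?case by simp
next
  case (Cons a w)
  show ?case
  proof (cases "c = a")
    case True
    then show ?thesis
      using Cons.prems assms(4)
      by (auto intro!: normal_prod_in_subspace word_field_stable assms(1))
  next
    case False
    then have "word_field X C w k u \<in> W" for k u
      using Cons by auto
    then show ?thesis
      using Cons.prems by (auto intro!: normal_prod_in_subspace assms(1))
  qed
qed

lemma iterated_deriv_field:
  "(deriv_field ^^ k) A n v = (\<Prod>j<k. of_int (int j - n)) *\<^sub>c A (n - int k) v"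
proof (induction k arbitrary: n)
  case 0
  show ?case by simp
next
  case (Suc k)
  have "(deriv_field ^^ Suc k) A n v = of_int (- n) *\<^sub>c (deriv_field ^^ k) A (n - 1) v"
    using deriv_field_def[of "(deriv_field ^^ k) A" n v] by simp
  also have "\<dots> = (of_int (- n) * (\<Prod>j<k. of_int (int j - (n - 1)))) *\<^sub>c A (n - 1 - int k) v"
    by (simp only: Suc cvec.scale_scale)
  also have "\<dots> = (\<Prod>j<Suc k. of_int (int j - n)) *\<^sub>c A (n - int (Suc k)) v"
  proof -
    have "of_int (- n) * (\<Prod>j<k. of_int (int j - (n - 1))) = (\<Prod>j<Suc k. of_int (int j - n) :: complex)"
      unfolding prod.lessThan_Suc_shift by (simp add: algebra_simps)
    moreover have "n - 1 - int k = n - int (Suc k)"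
      by simp
    ultimately show ?thesis by (simp only:)
  qed
  finally show ?case .
qed

lemma divided_deriv_in_subspace:
  assumes "cvec.subspace W" and "\<And>m. A m v \<in> W"
  shows "divided_deriv k A n v \<in> W"
  unfolding divided_deriv_def iterated_deriv_field by (intro cvec.subspace_scale assms)

text \<open>
  The coefficient of \<open>A (-1)\<close> in a proper derivative of \<open>A\<close> is zero: \<open>z\<^sup>0\<close> is a constant.
\<close>

lemma divided_deriv_in_subspace_except:
  assumes "cvec.subspace W" and "\<And>m. m \<noteq> -1 \<Longrightarrow> A m v \<in> W" and "k > 0"
  shows "divided_deriv k A n v \<in> W"
proof (cases "n - int k = -1")
  case True
  then have "k - 1 < k" "of_int (int (k - 1) - n) = (0 :: complex)"
    using \<open>k > 0\<close> by (simp_all only: of_int_eq_0_iff)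
  then have "(\<Prod>j<k. of_int (int j - n) :: complex) = 0"
    by (intro prod_zero) (simp, metis lessThan_iff)
  then show ?thesis
    unfolding divided_deriv_def iterated_deriv_field
    by (simp only: cvec.scale_zero_left cvec.scale_zero_right cvec.subspace_0[OF assms(1)])
next
  case False
  then show ?thesis
    unfolding divided_deriv_def iterated_deriv_field by (intro cvec.subspace_scale assms)
qed


section \<open>Stability of the kernel\<close>

lemma set_word_of:
  "a \<in> set (word_of ((A, B), (P, Q))) \<longleftrightarrow>
     (\<exists>k. k |\<in>| A \<and> a = Psi_l Pos k) \<or> (\<exists>k. k |\<in>| B \<and> a = Psi_l Neg k) \<or>
     (\<exists>k. k \<in># P \<and> a = Gamma_l Pos k) \<or> (\<exists>k. k \<in># Q \<and> a = Gamma_l Neg k)"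
  by (auto simp: sorted_list_of_fset.rep_eq)

lemma Psi_op_supported_on:
  assumes "v \<in> supported_on S"
    and "\<And>s g s'. (s, g) \<in> S \<Longrightarrow> s' \<in> Poly_Mapping.keys (psi_basis e n s) \<Longrightarrow> (s', g) \<in> S"
  shows "Psi_op e n v \<in> supported_on S"
  unfolding Psi_op_def on_left_def
  using assms(1)
proof (rule lin_ext_supported_on)
  fix b assume "b \<in> S"
  then show "(case b of (s, g) \<Rightarrow> lin_ext (\<lambda>s'. basis_vec (s', g)) (psi e n (basis_vec s)))
      \<in> supported_on S"
  proof (cases b)
    case (fields s P Q)
    define g where "g = (P, Q)"
    have "psi e n (basis_vec s) = psi_basis e n s"
      by (simp add: psi_def basis_vec_def)
    then show ?thesis
      using assms(2)[of s g] fields[folded g_def] \<open>b \<in> S\<close>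
      by (auto intro!: lin_ext_in_subspace[OF subspace_supported_on] basis_vec_supported_on)
  qed
qed

lemma Gamma_op_basis_vec:
  "Gamma_op e n (basis_vec (s, (P, Q))) =
    (if n < 0 then basis_vec (s, case e of Pos \<Rightarrow> (add_mset (nat (- n - 1)) P, Q)
                                     | Neg \<Rightarrow> (P, add_mset (nat (- n - 1)) Q))
     else 0)"
proof (cases "n < 0")
  case True
  then have "n = - int (nat (- n - 1)) - 1" by simp
  then show ?thesis
    using Gamma_op_basis[of e "nat (- n - 1)" s P Q] True by simp
next
  case False
  then show ?thesis
    by (simp add: Gamma_op_def on_right_def basis_vec_def gamma_def)
qed

lemma Gamma_op_supported_on:
  assumes "v \<in> supported_on S"
    and "\<And>s P Q. (s, (P, Q)) \<in> S \<Longrightarrow> n < 0 \<Longrightarrow> (s, case e of Pos \<Rightarrow> (add_mset (nat (- n - 1)) P, Q)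
                                     | Neg \<Rightarrow> (P, add_mset (nat (- n - 1)) Q)) \<in> S'"
  shows "Gamma_op e n v \<in> supported_on S'"
proof -
  have "Gamma_op e n v = lin_ext (\<lambda>b. Gamma_op e n (basis_vec b)) v"
    by (simp add: Gamma_op_def on_right_def basis_vec_def)
  moreover have "Gamma_op e n (basis_vec b) \<in> supported_on S'" if "b \<in> S" for b
  proof (cases b)
    case (fields s P Q)
    then show ?thesis
      using assms(2)[of s P Q] that
      by (auto simp: Gamma_op_basis_vec zero_supported_on intro: basis_vec_supported_on)
  qed
  ultimately show ?thesis
    using assms(1) by (auto intro: lin_ext_supported_on)
qed

lemma keys_psi_basis_Neg:
  assumes "(A', B') \<in> Poly_Mapping.keys (psi_basis Neg n (A, B))"
  shows "A' |\<subseteq>| A"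
  using assms by (auto split: if_splits)

lemma keys_psi_basis_Pos:
  assumes "(A', B') \<in> Poly_Mapping.keys (psi_basis Pos n (A, B))" "n \<noteq> -1" "0 |\<notin>| A"
  shows "0 |\<notin>| A'"
  using assms by (auto split: if_splits)

text \<open>
  These index the monomials divisible by some \<open>\<gamma>\<^sup>+(n)\<close>: the kernel of \<open>\<gamma>\<^sup>+ \<mapsto> 0\<close>.
\<close>

definition gamma_Pos_ideal :: "(fock \<times> gmono) set" where
  "gamma_Pos_ideal = {((A, B), (P, Q)) | A B P Q. P \<noteq> {#}}"

text \<open>
  These index the monomials whose image under \<open>\<gamma>\<^sup>+ \<mapsto> 0\<close> is killed by \<open>\<Psi>\<^sup>-(1/2)\<close>. The multiples
  of \<open>\<gamma>\<^sup>+\<close> have to be included because \<open>\<tau>\<^sup>+\<close> contains \<open>\<gamma>\<^sup>+(-1) \<Psi>\<^sup>+(-1/2) 1\<close>.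
\<close>

definition admissible :: "(fock \<times> gmono) set" where
  "admissible = {((A, B), (P, Q)) | A B P Q. P \<noteq> {#} \<or> 0 |\<notin>| A}"

lemma letter_field_gamma_Pos_ideal:
  assumes "v \<in> supported_on gamma_Pos_ideal"
  shows "letter_field Psi_op Gamma_op a n v \<in> supported_on gamma_Pos_ideal"
proof (cases a)
  case (Psi_l e k)
  then show ?thesis
    using assms
    by (auto intro!: divided_deriv_in_subspace subspace_supported_on Psi_op_supported_on
        simp: gamma_Pos_ideal_def)
next
  case (Gamma_l e k)
  then show ?thesis
    using assms
    by (auto intro!: divided_deriv_in_subspace subspace_supported_on
        Gamma_op_supported_on[where S = gamma_Pos_ideal] simp: gamma_Pos_ideal_def split: pm.splits)
qed

lemma letter_field_into_gamma_Pos_ideal: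
  "letter_field Psi_op Gamma_op (Gamma_l Pos k) n v \<in> supported_on gamma_Pos_ideal"
  by (auto intro!: divided_deriv_in_subspace subspace_supported_on
      Gamma_op_supported_on[where S = UNIV] simp: gamma_Pos_ideal_def supported_on_def[of UNIV])

lemma letter_field_admissible:
  assumes "v \<in> supported_on admissible" and "a \<noteq> Psi_l Pos 0"
  shows "letter_field Psi_op Gamma_op a n v \<in> supported_on admissible"
proof (cases a)
  case (Psi_l e k)
  show ?thesis
  proof (cases e)
    case Pos
    have "Psi_op Pos m v \<in> supported_on admissible" if "m \<noteq> -1" for m
      using assms(1)
      by (rule Psi_op_supported_on) (use keys_psi_basis_Pos that in \<open>fastforce simp: admissible_def\<close>)
    then show ?thesis
      using Psi_l Pos assms(2) by (auto intro!: divided_deriv_in_subspace_except subspace_supported_on)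
  next
    case Neg
    have "Psi_op Neg m v \<in> supported_on admissible" for m
      using assms(1)
      by (rule Psi_op_supported_on) (use keys_psi_basis_Neg in \<open>fastforce simp: admissible_def\<close>)
    then show ?thesis
      using Psi_l Neg by (auto intro!: divided_deriv_in_subspace subspace_supported_on)
  qed
next
  case (Gamma_l e k)
  then show ?thesis
    using assms
    by (auto intro!: divided_deriv_in_subspace subspace_supported_on
        Gamma_op_supported_on[where S = admissible] simp: admissible_def split: pm.splits)
qed

text \<open>
  If \<open>b\<close> contains a factor \<open>\<gamma>\<^sup>+\<close>, its field maps everything into the ideal of such monomials.
  Otherwise \<open>b\<close> is free of the letter \<open>\<Psi>\<^sup>+(-1/2)\<close>, and each letter preserves the span.
\<close>

lemma word_field_admissible:
  assumes "b \<in> admissible" and "v \<in> supported_on admissible"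
  shows "word_field Psi_op Gamma_op (word_of b) n v \<in> supported_on admissible"
proof -
  obtain A B P Q where b: "b = ((A, B), (P, Q))"
    by (metis surj_pair)
  show ?thesis
  proof (cases "P = {#}")
    case True
    then have "a \<noteq> Psi_l Pos 0" if "a \<in> set (word_of b)" for a
      using assms(1) that by (auto simp: b admissible_def set_word_of simp del: word_of.simps)
    then show ?thesis
      using assms(2) by (intro word_field_stable subspace_supported_on letter_field_admissible)
  next
    case False
    then obtain k where "k \<in># P" by blast
    then have c: "Gamma_l Pos k \<in> set (word_of b)"
      by (simp add: b set_word_of del: word_of.simps)
    have "word_field Psi_op Gamma_op (word_of b) n v \<in> supported_on gamma_Pos_ideal"
      by (rule word_field_absorbed[OF subspace_supported_on _ c letter_field_into_gamma_Pos_ideal])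
        (rule letter_field_gamma_Pos_ideal)
    moreover have "supported_on gamma_Pos_ideal \<subseteq> supported_on admissible"
      by (rule supported_on_mono) (auto simp: gamma_Pos_ideal_def admissible_def)
    ultimately show ?thesis by blast
  qed
qed

lemma V_subset_admissible: "V \<subseteq> supported_on admissible"
proof
  fix u assume "u \<in> V"
  then show "u \<in> supported_on admissible"
    unfolding V_def
  proof (induction rule: vertex_subalgebra_generated.induct)
    case vacuum
    show ?case
      by (auto simp: vacuum_def basis_vec_def admissible_def intro!: single_supported_on)
  next
    case (generator u)
    have "tau e \<in> supported_on admissible" for e
      unfolding tau_expand
      by (cases e; intro cvec.subspace_add subspace_supported_on)
        (auto simp: basis_vec_def admissible_def intro!: single_supported_on)
    moreover have "jvec \<in> supported_on admissible"
      unfolding jvec_expand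
      by (intro cvec.subspace_add subspace_supported_on single_supported_on)
        (auto simp: admissible_def)
    moreover have "nu \<in> supported_on admissible"
      unfolding nu_expand
      by (intro cvec.subspace_add subspace_supported_on single_supported_on)
        (auto simp: admissible_def)
    ultimately show ?case using generator by auto
  next
    case (add u v)
    then show ?case by (intro cvec.subspace_add subspace_supported_on)
  next
    case (scale u c)
    then show ?case by (intro cvec.subspace_scale subspace_supported_on)
  next
    case (nth_product u v n)
    then show ?case
      unfolding Y_def free_field_map_lin_ext
      by (blast intro: lin_ext_supported_on word_field_admissible)
  qed
qed

lemma psi_supported_on:
  assumes "v \<in> supported_on S"
    and "\<And>s s'. s \<in> S \<Longrightarrow> s' \<in> Poly_Mapping.keys (psi_basis e n s) \<Longrightarrow> s' \<in> S'"
  shows "psi e n v \<in> supported_on S'"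
  unfolding psi_def using assms(1)
  by (rule lin_ext_supported_on) (use assms(2) in \<open>auto simp: supported_on_def\<close>)

text \<open>
  Contraction with a fixed factor is injective on the monomials that contain it.
\<close>

lemma lookup_psi_Neg:
  assumes "a |\<in>| A"
  shows "Poly_Mapping.lookup (psi Neg (int a) v) (A |-| {|a|}, B) =
           (-1) ^ number_below a A * Poly_Mapping.lookup v (A, B)"
proof -
  have eq: "Poly_Mapping.lookup (psi_basis Neg (int a) b) (A |-| {|a|}, B) =
      (if b = (A, B) then (-1) ^ number_below a A else 0)" for b
  proof (cases b)
    case (Pair A' B')
    have "A' = A" if "a |\<in>| A'" "A' |-| {|a|} = A |-| {|a|}"
      using that assms by (metis finsert_fminus)
    then show ?thesis
      using Pair assms by (auto simp: lookup_single when_def)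
  qed
  show ?thesis
    by (simp add: psi_def lin_ext_def lookup_sum eq in_keys_iff if_distrib del: psi_basis.simps cong: if_cong)
qed

lemma lookup_psi_Pos:
  assumes "b |\<in>| B"
  shows "Poly_Mapping.lookup (psi Pos (int b) v) (A, B |-| {|b|}) =
           (-1) ^ (fcard A + number_below b B) * Poly_Mapping.lookup v (A, B)"
proof -
  have eq: "Poly_Mapping.lookup (psi_basis Pos (int b) s) (A, B |-| {|b|}) =
      (if s = (A, B) then (-1) ^ (fcard A + number_below b B) else 0)" for s
  proof (cases s)
    case (Pair A' B')
    have "B' = B" if "b |\<in>| B'" "B' |-| {|b|} = B |-| {|b|}"
      using that assms by (metis finsert_fminus)
    then show ?thesis
      using Pair assms by (auto simp: lookup_single when_def)
  qed
  show ?thesis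
    by (simp add: psi_def lin_ext_def lookup_sum eq in_keys_iff if_distrib del: psi_basis.simps cong: if_cong)
qed

text \<open>
  Turns the kernel of \<open>\<Psi>\<^sup>-(1/2)\<close> into a coordinate subspace; the contraction being injective on the
  monomials with factor \<open>\<Psi>\<^sup>+(-1/2)\<close>, every vector of the kernel is
  free of them.
\<close>

lemma F_tilde_eq: "F_tilde = supported_on {(A, B). 0 |\<notin>| A}"
proof (intro equalityI subsetI)
  fix v assume "v \<in> F_tilde"
  then have v: "psi Neg 0 v = 0" by (simp add: F_tilde_def)
  have "0 |\<notin>| A" if "(A, B) \<in> Poly_Mapping.keys v" for A B
    using lookup_psi_Neg[of 0 A v B] v that by (auto simp: in_keys_iff)
  then show "v \<in> supported_on {(A, B). 0 |\<notin>| A}"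
    by (auto simp: supported_on_def)
next
  fix v :: "fock vec" assume "v \<in> supported_on {(A, B). 0 |\<notin>| A}"
  then have "psi Neg 0 v \<in> supported_on {}"
    by (rule psi_supported_on) auto
  then show "v \<in> F_tilde"
    by (simp add: supported_on_def F_tilde_def)
qed

lemma psi_Pos_F_tilde: "v \<in> F_tilde \<Longrightarrow> n \<noteq> -1 \<Longrightarrow> psi Pos n v \<in> F_tilde"
  unfolding F_tilde_eq by (erule psi_supported_on) (use keys_psi_basis_Pos in blast)

lemma psi_Neg_F_tilde: "v \<in> F_tilde \<Longrightarrow> psi Neg n v \<in> F_tilde"
  unfolding F_tilde_eq by (erule psi_supported_on) (use keys_psi_basis_Neg in blast)

lemma subspace_F_tilde: "cvec.subspace F_tilde"
  by (simp add: F_tilde_eq subspace_supported_on)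

lemma letter_field_F_tilde:
  assumes "v \<in> F_tilde" and "a \<noteq> Psi_l Pos 0"
  shows "letter_field psi (chi_field \<chi>\<^sub>1 \<chi>\<^sub>2) a n v \<in> F_tilde"
proof (cases a)
  case (Psi_l e k)
  show ?thesis
  proof (cases e)
    case Pos
    then show ?thesis
      using Psi_l assms
      by (auto intro!: divided_deriv_in_subspace_except subspace_F_tilde psi_Pos_F_tilde)
  next
    case Neg
    then show ?thesis
      using Psi_l assms
      by (auto intro!: divided_deriv_in_subspace subspace_F_tilde psi_Neg_F_tilde)
  qed
next
  case (Gamma_l e k)
  then show ?thesis
    using assms by (auto intro!: divided_deriv_in_subspace subspace_F_tilde cvec.subspace_scale
        simp: chi_field_alt)
qed

lemma subspace_zero: "cvec.subspace {0}"
  by (auto simp: cvec.subspace_def)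

text \<open>
  The same two cases on the module, where \<open>\<gamma>\<^sup>+\<close> acts as \<open>\<chi>\<^sup>+ = 0\<close>, so that \<open>{0}\<close> takes the place of
  the ideal.
\<close>

lemma word_field_F_tilde:
  assumes "b \<in> admissible" and "v \<in> F_tilde"
  shows "word_field psi (chi_field 0 \<chi>) (word_of b) n v \<in> F_tilde"
proof -
  obtain A B P Q where b: "b = ((A, B), (P, Q))"
    by (metis surj_pair)
  show ?thesis
  proof (cases "P = {#}")
    case True
    then have "a \<noteq> Psi_l Pos 0" if "a \<in> set (word_of b)" for a
      using assms(1) that by (auto simp: b admissible_def set_word_of simp del: word_of.simps)
    then show ?thesis
      using assms(2) by (intro word_field_stable subspace_F_tilde letter_field_F_tilde)
  next
    case False
    then obtain k where "k \<in># P" by blast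
    then have c: "Gamma_l Pos k \<in> set (word_of b)"
      by (simp add: b set_word_of del: word_of.simps)
    have kill: "letter_field psi (chi_field 0 \<chi>) (Gamma_l Pos k) m u \<in> {0}" for m u
      using divided_deriv_in_subspace[OF subspace_zero, of "chi_field 0 \<chi> Pos"]
      by (simp add: chi_mode_zero)
    have zero: "letter_field psi (chi_field 0 \<chi>) a m u \<in> {0}" if "u \<in> {0}" for a m u
      using that
      by (cases a) (auto simp: divided_deriv_def iterated_deriv_field chi_field_vec_zero)
    have "word_field psi (chi_field 0 \<chi>) (word_of b) n v \<in> {0}"
      using c kill zero by (intro word_field_absorbed subspace_zero)
    then show ?thesis
      by (simp add: cvec.subspace_0 subspace_F_tilde)
  qed
qed

lemma is_submodule_F_tilde: "is_submodule V (Y_F 0 \<chi>) F_tilde"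
  unfolding is_submodule_def
proof (intro conjI ballI allI)
  fix u n w assume "u \<in> V" "w \<in> F_tilde"
  then show "Y_F 0 \<chi> u n w \<in> F_tilde"
    using V_subset_admissible
    unfolding Y_F_def free_field_map_lin_ext
    by (intro lin_ext_in_subspace subspace_F_tilde word_field_F_tilde) (auto simp: supported_on_def)
qed (rule subspace_F_tilde)


section \<open>The Clifford operators generated by the modes\<close>

lemma tau_in_V: "tau e \<in> V"
  unfolding V_def by (rule vertex_subalgebra_generated.generator) (cases e; simp)

lemma submodule_psi_Pos:
  assumes "is_submodule V (Y_F 0 \<chi>) W" and "v \<in> W" and "n \<noteq> -1"
  shows "psi Pos n v \<in> W"
proof -
  have "Y_F 0 \<chi> (tau Pos) (n + 1) v = of_int (- (n + 1)) *\<^sub>c psi Pos n v"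
    by (simp add: Y_F_tau chi_mode_zero)
  moreover have "Y_F 0 \<chi> (tau Pos) (n + 1) v \<in> W"
    using assms tau_in_V by (auto simp: is_submodule_def)
  moreover have "of_int (- (n + 1)) \<noteq> (0 :: complex)"
    using \<open>n \<noteq> -1\<close> by (simp only: of_int_eq_0_iff)
  ultimately show ?thesis
    using assms(1) by (metis cvec.subspace_scale cvec.scale_scale cvec.scale_one is_submodule_def
        left_inverse)
qed

lemma psi_Neg_eventually_zero: "\<exists>N. \<forall>n\<ge>N. psi Neg n v = 0"
proof -
  define U where "U = (\<Union>b\<in>Poly_Mapping.keys v. fset (fst b))"
  have fin: "finite U" by (simp add: U_def)
  have "psi Neg n v = 0" if n: "n \<ge> int (Suc (Max (insert 0 U)))" for n
  proof -
    have "psi_basis Neg n b = 0" if b: "b \<in> Poly_Mapping.keys v" for b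
    proof -
      have "nat n |\<notin>| fst b"
      proof
        assume "nat n |\<in>| fst b"
        then have "nat n \<le> Max (insert 0 U)"
          using b fin by (intro Max_ge) (auto simp: U_def)
        with n show False by linarith
      qed
      then show ?thesis using n by (cases b) auto
    qed
    then show ?thesis by (simp add: psi_def lin_ext_def)
  qed
  then show ?thesis by blast
qed

text \<open>
  The vectors \<open>x n\<close> stand for \<open>\<Psi>\<^sup>-(n+1/2) v\<close>. The combination with index \<open>i\<close> starts with a multiple
  of \<open>x (i - 1 - p)\<close>, and all its other terms have higher index. As \<open>x n\<close> vanishes for large \<open>n\<close>,
  downward induction recovers each \<open>x n\<close> from the combinations. For \<open>p = 0\<close> the derivative term
  \<open>- i x (i - 1)\<close> is part of the leading term, for \<open>p > 0\<close> it is not. At \<open>n = 0\<close> the leading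
  coefficient may vanish, which is why \<open>x 0\<close> is supplied separately.
\<close>

lemma triangular_modes_stable:
  fixes x :: "int \<Rightarrow> 'b vec" and c :: "int \<Rightarrow> complex" and p :: nat
  assumes W: "cvec.subspace W"
    and comb: "\<And>i. of_int (- i) *\<^sub>c x (i - 1) + Sum_any (\<lambda>k. c (- k) *\<^sub>c x (k + i - 1)) \<in> W"
    and c0: "\<And>n. n > int p \<Longrightarrow> c n = 0"
    and lead: "\<And>n. n \<noteq> 0 \<Longrightarrow> c p - (if p = 0 then of_int (n + 1) else 0) \<noteq> 0"
    and x0: "x 0 \<in> W"
    and N: "\<And>n. n \<ge> N \<Longrightarrow> x n = 0"
  shows "x n \<in> W"
proof -
  have "\<forall>n \<ge> N - int d. x n \<in> W" for d
  proof (induction d)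
    case 0
    then show ?case using N cvec.subspace_0[OF W] by simp
  next
    case (Suc d)
    define m where "m = N - int d - 1"
    have IH: "x n \<in> W" if "n > m" for n
      using Suc that by (simp add: m_def)
    have "x m \<in> W"
    proof (cases "m = 0")
      case True
      then show ?thesis using x0 by simp
    next
      case False
      (* The combination that starts with x m. *)
      define i where "i = m + 1 + int p"
      define f where "f k = c (- k) *\<^sub>c x (k + i - 1)" for k
      (* Below - p the coefficients of f vanish, and above N - i the vectors do. *)
      define K where "K = {- int p..N - i}"
      define R where "R = (\<Sum>k\<in>K - {- int p}. f k)"
      have nz: "k \<in> insert (- int p) K" if "f k \<noteq> 0" for k
      proof (rule ccontr)
        assume "k \<notin> insert (- int p) K"
        then have "- k > int p \<or> k + i - 1 \<ge> N" 
          by (auto simp: K_def i_def)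
        then show False using that c0 N by (auto simp: f_def)
      qed
      have "Sum_any f = sum f (insert (- int p) K)"
        using nz by (intro Sum_any.expand_superset) (simp add: K_def, blast)
      also have "\<dots> = f (- int p) + R"
        unfolding R_def by (rule sum.insert_remove) (simp add: K_def)
      finally have sum: "Sum_any f = c (int p) *\<^sub>c x m + R"
        by (simp add: f_def i_def)
      have "f k \<in> W" if "k \<in> K - {- int p}" for k
        unfolding f_def using that by (intro cvec.subspace_scale W IH) (auto simp: K_def i_def)
      then have R: "R \<in> W"
        unfolding R_def by (intro cvec.subspace_sum W)
      have mem: "of_int (- i) *\<^sub>c x (i - 1) + (c (int p) *\<^sub>c x m + R) \<in> W"
        using comb[of i] by (simp only: f_def[symmetric] sum)
      define l where "l = c (int p) - (if p = 0 then of_int (m + 1) else 0)"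
      have "l *\<^sub>c x m \<in> W"
      proof (cases "p = 0")
        case True
        then have "l *\<^sub>c x m = (of_int (- i) *\<^sub>c x (i - 1) + (c (int p) *\<^sub>c x m + R)) - R"
          by (simp add: l_def i_def cvec.scale_left_diff_distrib cvec.scale_left_distrib)
        then show ?thesis using mem R cvec.subspace_diff[OF W] by metis
      next
        case False
        then have "of_int (- i) *\<^sub>c x (i - 1) \<in> W"
          by (intro cvec.subspace_scale W IH) (simp add: i_def)
        moreover have "l *\<^sub>c x m = (of_int (- i) *\<^sub>c x (i - 1) + (c (int p) *\<^sub>c x m + R))
            - of_int (- i) *\<^sub>c x (i - 1) - R"
          using False by (simp add: l_def)
        ultimately show ?thesis using mem R cvec.subspace_diff[OF W] by metis
      qed
      moreover have "l \<noteq> 0" using lead[OF False] by (simp add: l_def)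
      ultimately have "inverse l *\<^sub>c (l *\<^sub>c x m) \<in> W" "inverse l *\<^sub>c (l *\<^sub>c x m) = x m"
        using cvec.subspace_scale[OF W] by (blast, simp)
      then show ?thesis by simp
    qed
    then show ?case
      using IH by (smt (verit) m_def of_nat_Suc)
  qed
  from this[of "nat (N - n)"] show ?thesis by simp
qed

lemma submodule_psi_Neg:
  fixes p :: nat
  assumes sub: "is_submodule V (Y_F 0 \<chi>) W" and "W \<subseteq> F_tilde" and "v \<in> W"
    and zero: "\<And>n. n > int p \<Longrightarrow> chi_mode \<chi> n = 0"
    and "chi_mode \<chi> (int p) \<noteq> 0"
    and "p = 0 \<Longrightarrow> chi_mode \<chi> 0 \<in> {1} \<union> (UNIV - \<int>)"
  shows "psi Neg n v \<in> W"
proof -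
  obtain N where N: "\<And>n. n \<ge> N \<Longrightarrow> psi Neg n v = 0"
    using psi_Neg_eventually_zero by blast
  have W: "cvec.subspace W"
    using sub by (simp add: is_submodule_def)
  show ?thesis
  proof (rule triangular_modes_stable[OF W _ zero])
    show "of_int (- i) *\<^sub>c psi Neg (i - 1) v
        + Sum_any (\<lambda>k. chi_mode \<chi> (- k) *\<^sub>c psi Neg (k + i - 1) v) \<in> W" for i
    proof -
      have "Y_F 0 \<chi> (tau Neg) i v \<in> W"
        using sub tau_in_V \<open>v \<in> W\<close> by (auto simp: is_submodule_def)
      then show ?thesis by (simp add: Y_F_tau)
    qed
  next
    fix n :: int assume "n \<noteq> 0"
    show "chi_mode \<chi> p - (if p = 0 then of_int (n + 1) else 0) \<noteq> 0"
    proof (cases "p = 0")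
      case True
      have "chi_mode \<chi> 0 \<noteq> of_int (n + 1)"
      proof
        assume eq: "chi_mode \<chi> 0 = of_int (n + 1)"
        then have "chi_mode \<chi> 0 = 1"
          using assms(6)[OF True] by auto
        with eq \<open>n \<noteq> 0\<close> show False by simp
      qed
      with True show ?thesis by simp
    qed (use assms(5) in simp)
  next
    show "psi Neg 0 v \<in> W"
      using \<open>v \<in> W\<close> \<open>W \<subseteq> F_tilde\<close> cvec.subspace_0[OF W] by (auto simp: F_tilde_def)
  qed (use N in auto)
qed


section \<open>Irreducibility of the Clifford module\<close>

lemma fcard_pos: "a |\<in>| A \<Longrightarrow> fcard A > 0"
  by (metis fcard_Suc_fminus1 zero_less_Suc)

text \<open>
  Contracting with a factor that occurs in some monomial of \<open>v\<close> leaves a nonzero vector and lowers the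
  number of factors of every surviving monomial, so repeated contraction ends at the vacuum.
\<close>

lemma fock_vacuum_in_subspace:
  assumes W: "cvec.subspace W"
    and Pos: "\<And>n v. n \<ge> 0 \<Longrightarrow> v \<in> W \<Longrightarrow> psi Pos n v \<in> W"
    and Neg: "\<And>n v. n \<ge> 0 \<Longrightarrow> v \<in> W \<Longrightarrow> psi Neg n v \<in> W"
    and "v \<in> W" "v \<noteq> 0" "v \<in> supported_on {(A, B). fcard A + fcard B \<le> d}"
  shows "fock_vacuum \<in> W"
  using assms(4-)
proof (induction d arbitrary: v)
  case 0
  then have keys: "Poly_Mapping.keys v \<subseteq> {({||}, {||})}"
    by (auto simp: supported_on_def)
  define c where "c = Poly_Mapping.lookup v ({||}, {||})"
  have v: "v = c *\<^sub>c fock_vacuum"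
    using keys unfolding c_def fock_vacuum_def basis_vec_def
    by (intro poly_mapping_eqI) (auto simp: lookup_single when_def in_keys_iff)
  then have "c \<noteq> 0" using 0 by auto
  then have "inverse c *\<^sub>c v = fock_vacuum" using v by simp
  then show ?case using cvec.subspace_scale[OF W 0(1)] by metis
next
  case (Suc d)
  show ?case
  proof (cases "v \<in> supported_on {(A, B). fcard A + fcard B \<le> 0}")
    case True
    moreover have "supported_on {(A, B). fcard A + fcard B \<le> 0}
        \<subseteq> supported_on {(A, B). fcard A + fcard B \<le> d}"
      by (rule supported_on_mono) (clarify, linarith)
    ultimately have "v \<in> supported_on {(A, B). fcard A + fcard B \<le> d}"
      by (rule rev_subsetD)
    then show ?thesis using Suc by blast
  next
    case False
    then obtain A B where AB: "(A, B) \<in> Poly_Mapping.keys v" and ne: "A \<noteq> {||} \<or> B \<noteq> {||}"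
      by (auto simp: supported_on_def)
    from ne show ?thesis
    proof
      assume "A \<noteq> {||}"
      then obtain a where a: "a |\<in>| A" by auto
      have "psi Neg (int a) v \<in> supported_on {(A, B). fcard A + fcard B \<le> d}"
        using Suc.prems(3)
        by (rule psi_supported_on) (clarsimp split: if_splits, drule fcard_pos, linarith)
      moreover have "psi Neg (int a) v \<noteq> 0"
        using lookup_psi_Neg[OF a, of v B] AB by (auto simp: in_keys_iff)
      ultimately show ?thesis using Suc.IH[OF Neg[OF _ Suc.prems(1), of "int a"]] by (metis of_nat_0_le_iff)
    next
      assume "B \<noteq> {||}"
      then obtain b where b: "b |\<in>| B" by auto
      have "psi Pos (int b) v \<in> supported_on {(A, B). fcard A + fcard B \<le> d}"
        using Suc.prems(3)
        by (rule psi_supported_on) (clarsimp split: if_splits, drule fcard_pos, linarith)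
      moreover have "psi Pos (int b) v \<noteq> 0"
        using lookup_psi_Pos[OF b, of v A] AB by (auto simp: in_keys_iff)
      ultimately show ?thesis using Suc.IH[OF Pos[OF _ Suc.prems(1), of "int b"]] by (metis of_nat_0_le_iff)
    qed
  qed
qed

lemma basis_vec_up_to_sign:
  assumes "cvec.subspace W" and "Poly_Mapping.single b ((-1) ^ k) \<in> W"
  shows "basis_vec b \<in> W"
  using cvec.subspace_scale[OF assms, of "(-1) ^ k"]
  by (simp add: basis_vec_def flip: power_add mult_2)

lemma F_tilde_subset:
  assumes W: "cvec.subspace W"
    and Pos: "\<And>n v. n < -1 \<Longrightarrow> v \<in> W \<Longrightarrow> psi Pos n v \<in> W"
    and Neg: "\<And>n v. n < 0 \<Longrightarrow> v \<in> W \<Longrightarrow> psi Neg n v \<in> W"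
    and vac: "fock_vacuum \<in> W"
  shows "F_tilde \<subseteq> W"
proof
  have B: "basis_vec ({||}, B) \<in> W" for B
  proof (induction B)
    case empty
    then show ?case using vac by (simp add: fock_vacuum_def)
  next
    case (insert b B)
    then have "psi Neg (- int b - 1) (basis_vec ({||}, B)) \<in> W" using Neg by simp
    then show ?case
      using insert by (auto simp: psi_def basis_vec_def[of "({||}, B)"] intro: basis_vec_up_to_sign[OF W])
  qed
  have AB: "basis_vec (A, B) \<in> W" if "0 |\<notin>| A" for A B
    using that
  proof (induction A)
    case empty
    then show ?case using B by simp
  next
    case (insert a A)
    then have "psi Pos (- int a - 1) (basis_vec (A, B)) \<in> W" using Pos by (simp add: not_less)
    then show ?case
      using insert by (auto simp: psi_def basis_vec_def[of "(A, B)"] intro: basis_vec_up_to_sign[OF W])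
  qed
  fix v assume "v \<in> F_tilde"
  then have "lin_ext basis_vec v \<in> W"
    using AB by (intro lin_ext_in_subspace W) (auto simp: F_tilde_eq supported_on_def)
  then show "v \<in> W" by (simp add: lin_ext_basis_vec)
qed

theorem proposition5p2:
  fixes p :: nat and \<chi> :: "complex fls"
  assumes "\<And>n. n > int p \<Longrightarrow> chi_mode \<chi> n = 0"
    and "chi_mode \<chi> (int p) \<noteq> 0"
    and "p = 0 \<Longrightarrow> chi_mode \<chi> 0 \<in> {1} \<union> (UNIV - \<int>)"
  shows "is_irreducible_module V (Y_F 0 \<chi>) F_tilde"
  unfolding is_irreducible_module_def
proof (intro conjI allI impI is_submodule_F_tilde)
  have "fock_vacuum \<in> F_tilde"
    by (auto simp: F_tilde_eq fock_vacuum_def intro: basis_vec_supported_on)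
  moreover have "fock_vacuum \<noteq> 0"
    unfolding fock_vacuum_def basis_vec_def by (metis lookup_single_eq lookup_zero zero_neq_one)
  ultimately show "F_tilde \<noteq> {0}" by blast
next
  fix W assume asm: "W \<subseteq> F_tilde \<and> is_submodule V (Y_F 0 \<chi>) W"
  then have W: "cvec.subspace W" by (simp add: is_submodule_def)
  have Pos: "psi Pos n v \<in> W" if "n \<noteq> -1" "v \<in> W" for n v
    using submodule_psi_Pos asm that by blast
  have Neg: "psi Neg n v \<in> W" if "v \<in> W" for n v
    using submodule_psi_Neg[OF _ _ that assms] asm by blast
  show "W = {0} \<or> W = F_tilde"
  proof (cases "W = {0}")
    case False
    then obtain v where v: "v \<in> W" "v \<noteq> 0"
      using cvec.subspace_0[OF W] by blast
    define d where "d = Max ((\<lambda>(A, B). fcard A + fcard B) ` Poly_Mapping.keys v)"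
    have "fcard A + fcard B \<le> d" if "(A, B) \<in> Poly_Mapping.keys v" for A B
      unfolding d_def using that by (intro Max_ge) force+
    then have "v \<in> supported_on {(A, B). fcard A + fcard B \<le> d}"
      by (auto simp: supported_on_def)
    then have "fock_vacuum \<in> W"
      using fock_vacuum_in_subspace[OF W _ _ v] Pos Neg by auto
    then have "F_tilde \<subseteq> W"
      using F_tilde_subset[OF W] Pos Neg by auto
    then show ?thesis using asm by blast
  qed simp
qed

end
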